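(* Let $k \in \mathbb{N}$, let $\langle B_i \mid i \in \{1,\ldots,k\}\rangle$ be a family of abelian groups, let $A$ and $C$ be abelian groups, and for each $i \in \{1,\ldots,k\}$, let $f_i : A \to B_i$ be a function. Let $g : \prod_{i=1}^k B_i \to C$ be a function, and let $G : A \to C$ be defined by $G(a) := g(f_1(a),\ldots,f_k(a))$ for all $a \in A$. Then $$\operatorname{Fdeg}(G) \le \sum_{i=1}^k \operatorname{Pdeg}_i(g) \cdot \operatorname{Fdeg}(f_i).$$
   Context: $\mathbb{N}$ is the set of positive integers, $\mathbb{N}_0 = \mathbb{N} \cup \{0\}$; abelian groups are written additively. For an abelian group $A$, $\mathbb{Z}[A]$ is the integral group ring; its elements are written as finite sums $\sum_{a\in A} z_a \tau_a$ with $z_a \in \mathbb{Z}$, and $\tau_a \cdot \tau_b = \tau_{a+b}$. The augmentation ideal $\operatorname{Aug}(\mathbb{Z}[A])$ is the ideal of $\mathbb{Z}[A]$ generated by $\{\tau_a - 1 \mid a \in A\}$. For an ideal $I$, $I^0 = \mathbb{Z}[A]$ and $I^n$ is the ideal generated by all products $i_1\cdots i_n$ with $i_1,\ldots,i_n \in I$. For an abelian group $B$, the ring $\mathbb{Z}[A]$ acts on the group $B^A$ of all functions $f : A \to B$ by $((\sum_{a} z_a \tau_a) * f)(x) = \sum_{a} z_a f(x+a)$. For an ideal $J$, $J * f = 0$ means $j * f = 0$ for all $j \in J$. Functional degree: for a function $f : A \to B$ between abelian groups and $I := \operatorname{Aug}(\mathbb{Z}[A])$, $\operatorname{Fdeg}(f)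 := \min\{ n \in \mathbb{N}_0 \mid I^{n+1} * f = 0\}$, with $\operatorname{Fdeg}(f) = \infty$ if no such $n$ exists. Partial degree: let $A_1,\ldots,A_k$, $C$ be abelian groups, $f : \prod_{j=1}^k A_j \to C$ and $i \in \{1,\ldots,k\}$. For $\mathbf{a} = (a_1,\ldots,a_k) \in \prod_j A_j$ let $E^{(i)}_{\mathbf{a}} : A_i \to \prod_{j=1}^k A_j$, $E^{(i)}_{\mathbf{a}}(x) = (a_1,\ldots,a_{i-1},x,a_{i+1},\ldots,a_k)$. Then $\operatorname{Pdeg}_i(f) := \sup\{\operatorname{Fdeg}(f \circ E^{(i)}_{\mathbf{a}}) \mid \mathbf{a} \in \prod_{j=1}^k A_j\} \in \mathbb{N}_0 \cup \{\infty\}$. Arithmetic is in $\mathbb{N}_0 \cup \{\infty\}$ with $0\cdot\infty = \infty \cdot 0 = 0$, and $n \cdot \infty = \infty\cdot n = \infty$ for $n > 0$ (including $n=\infty$). *)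

theory Defs
  imports
    "HOL-Algebra.Algebra"
    "HOL-Library.Poly_Mapping"
    "HOL-Library.Extended_Nat"
begin

text \<open>
  Groups are HOL-Algebra records, hence written multiplicatively: \<open>x + a\<close>, \<open>z f\<close> and \<open>0\<close>
  of the additive notation appear as \<open>x \<otimes> a\<close>, \<open>f [^] z\<close> and \<open>\<one>\<close>.
\<close>

text \<open>
  The integral group ring of \<open>A\<close>: finitely supported integer-valued functions with support in
  the carrier of \<open>A\<close>, where \<open>frag_of a\<close> is the basis element \<open>\<tau>\<^sub>a\<close>.  The multiplication is the
  bilinear extension of \<open>\<tau>\<^sub>a \<tau>\<^sub>b = \<tau>\<^sub>a\<^sub>+\<^sub>b\<close>.
\<close>

definition int_group_ring :: "('a, 'm) monoid_scheme \<Rightarrow> ('a \<Rightarrow>\<^sub>0 int) ring" where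
  "int_group_ring A =
    \<lparr>carrier = {z. Poly_Mapping.keys z \<subseteq> carrier A},
     monoid.mult = (\<lambda>z w. \<Sum>a\<in>Poly_Mapping.keys z. \<Sum>b\<in>Poly_Mapping.keys w.
        frag_cmul (Poly_Mapping.lookup z a * Poly_Mapping.lookup w b) (frag_of (a \<otimes>\<^bsub>A\<^esub> b))),
     one = frag_of \<one>\<^bsub>A\<^esub>,
     ring.zero = 0,
     ring.add = (+)\<rparr>"

definition aug_ideal :: "('a, 'm) monoid_scheme \<Rightarrow> ('a \<Rightarrow>\<^sub>0 int) set" where
  "aug_ideal A = Idl\<^bsub>int_group_ring A\<^esub> {frag_of a - frag_of \<one>\<^bsub>A\<^esub> |a. a \<in> carrier A}"

definition ideal_power :: "('r, 'm) ring_scheme \<Rightarrow> 'r set \<Rightarrow> nat \<Rightarrow> 'r set" where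
  "ideal_power R I n =
    (if n = 0 then carrier R
     else Idl\<^bsub>R\<^esub> {finprod R u {1..n} |u. u \<in> {1..n} \<rightarrow> I})"

definition group_ring_act ::
  "('a, 'm) monoid_scheme \<Rightarrow> ('b, 'n) monoid_scheme \<Rightarrow> ('a \<Rightarrow>\<^sub>0 int) \<Rightarrow> ('a \<Rightarrow> 'b) \<Rightarrow> 'a \<Rightarrow> 'b" where
  "group_ring_act A B z f x =
    finprod B (\<lambda>a. f (x \<otimes>\<^bsub>A\<^esub> a) [^]\<^bsub>B\<^esub> Poly_Mapping.lookup z a) (Poly_Mapping.keys z)"

definition annihilates ::
  "('a, 'm) monoid_scheme \<Rightarrow> ('b, 'n) monoid_scheme \<Rightarrow> ('a \<Rightarrow>\<^sub>0 int) set \<Rightarrow> ('a \<Rightarrow> 'b) \<Rightarrow> bool" where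
  "annihilates A B J f \<longleftrightarrow> (\<forall>j\<in>J. \<forall>x\<in>carrier A. group_ring_act A B j f x = \<one>\<^bsub>B\<^esub>)"

definition Fdeg ::
  "('a, 'm) monoid_scheme \<Rightarrow> ('b, 'n) monoid_scheme \<Rightarrow> ('a \<Rightarrow> 'b) \<Rightarrow> enat" where
  "Fdeg A B f =
    (if \<exists>n. annihilates A B (ideal_power (int_group_ring A) (aug_ideal A) (Suc n)) f
     then enat (LEAST n. annihilates A B (ideal_power (int_group_ring A) (aug_ideal A) (Suc n)) f)
     else \<infinity>)"

text \<open>
  The partial degree, in the \<open>i\<close>-th coordinate, of a function \<open>g\<close> on the product of the groups
  \<open>B j\<close> for \<open>j \<in> I\<close>.  Overwriting the \<open>i\<close>-th coordinate of \<open>b\<close> is the embedding of \<open>B i\<close> into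
  the product at \<open>b\<close>.
\<close>

definition Pdeg ::
  "'i set \<Rightarrow> ('i \<Rightarrow> ('b, 'm) monoid_scheme) \<Rightarrow> ('c, 'n) monoid_scheme \<Rightarrow> 'i \<Rightarrow>
    (('i \<Rightarrow> 'b) \<Rightarrow> 'c) \<Rightarrow> enat" where
  "Pdeg I B C i g =
    (SUP b \<in> carrier (product_group I B). Fdeg (B i) C (\<lambda>x. g (b(i := x))))"

text \<open>\<open>Idl\<close> and \<open>finprod\<close> above are only meaningful in a commutative ring.\<close>

lemma int_group_ring_mult_extend:
  "z \<otimes>\<^bsub>int_group_ring A\<^esub> w =
    frag_extend (\<lambda>a. frag_extend (\<lambda>b. frag_of (a \<otimes>\<^bsub>A\<^esub> b)) w) z"
  by (simp add: int_group_ring_def frag_extend_def frag_cmul_sum)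

lemma cring_int_group_ring:
  assumes "comm_group A"
  shows "cring (int_group_ring A)"
proof -
  interpret G: comm_group A by fact
  let ?R = "int_group_ring A"
  define m where "m = monoid.mult ?R"
  have carr: "z \<in> carrier ?R \<longleftrightarrow> Poly_Mapping.keys z \<subseteq> carrier A" for z
    by (simp add: int_group_ring_def)
  have add [simp]: "z \<oplus>\<^bsub>?R\<^esub> w = z + w" for z w by (simp add: int_group_ring_def)
  have zero [simp]: "\<zero>\<^bsub>?R\<^esub> = 0" by (simp add: int_group_ring_def)
  have one [simp]: "\<one>\<^bsub>?R\<^esub> = frag_of \<one>\<^bsub>A\<^esub>" by (simp add: int_group_ring_def)
  have ladd: "m (y - z) w = m y w - m z w" for y z w
    by (simp add: m_def int_group_ring_mult_extend frag_extend_diff)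
  have ladd': "m (y + z) w = m y w + m z w" for y z w
    by (simp add: m_def int_group_ring_mult_extend frag_extend_add)
  have frag_cmul_diff_distrib2: "frag_cmul c (y - z) = frag_cmul c y - frag_cmul c z"
    for c and y z :: "'a \<Rightarrow>\<^sub>0 int"
    by (auto simp: right_diff_distrib lookup_minus poly_mapping_eqI)
  have radd: "m w (y - z) = m w y - m w z" for y z w
    unfolding m_def int_group_ring_mult_extend
    by (simp only: frag_extend_diff)
      (simp only: frag_extend_def[where x = w] frag_cmul_diff_distrib2 sum_subtractf)
  have l0: "m 0 w = 0" and r0: "m w 0 = 0" for w
    by (simp_all add: m_def int_group_ring_mult_extend frag_extend_def)
  have of: "m (frag_of a) (frag_of b) = frag_of (a \<otimes>\<^bsub>A\<^esub> b)" for a b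
    by (simp add: m_def int_group_ring_mult_extend)
  note bil = ladd radd l0 r0
  have closed: "Poly_Mapping.keys (m z w) \<subseteq> carrier A"
    if "Poly_Mapping.keys z \<subseteq> carrier A" "Poly_Mapping.keys w \<subseteq> carrier A" for z w
    using that(1)
  proof (induction rule: frag_induction)
    case (diff x y) then show ?case using keys_diff[of "m x w" "m y w"] by (auto simp: bil)
  next
    case (one a)
    show ?case using that(2)
    proof (induction rule: frag_induction)
      case (diff x y)
      then show ?case
        using keys_diff[of "m (frag_of a) x" "m (frag_of a) y"] by (auto simp: bil)
    qed (use one in \<open>auto simp: bil of\<close>)
  qed (simp add: bil)
  have comm: "m z w = m w z"
    if "Poly_Mapping.keys z \<subseteq> carrier A" "Poly_Mapping.keys w \<subseteq> carrier A" for z w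
    using that(1)
  proof (induction rule: frag_induction)
    case (one a)
    show ?case using that(2)
      by (induction rule: frag_induction) (use one in \<open>auto simp: bil of G.m_comm\<close>)
  qed (simp_all add: bil)
  have assoc: "m (m z w) v = m z (m w v)"
    if "Poly_Mapping.keys z \<subseteq> carrier A" "Poly_Mapping.keys w \<subseteq> carrier A"
       "Poly_Mapping.keys v \<subseteq> carrier A" for z w v
    using that(1)
  proof (induction rule: frag_induction)
    case (one a)
    show ?case using that(2)
    proof (induction rule: frag_induction)
      case (one b)
      show ?case using that(3)
        by (induction rule: frag_induction)
          (use one \<open>a \<in> carrier A\<close> in \<open>auto simp: bil of G.m_assoc\<close>)
    qed (simp_all add: bil)
  qed (simp_all add: bil)
  have lone: "m (frag_of \<one>\<^bsub>A\<^esub>) z = z" if "Poly_Mapping.keys z \<subseteq> carrier A" for z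
    using that
    by (induction rule: frag_induction) (auto simp: bil of)
  have keys_plus: "Poly_Mapping.keys (z + w) \<subseteq> carrier A"
    if "Poly_Mapping.keys z \<subseteq> carrier A" "Poly_Mapping.keys w \<subseteq> carrier A"
    for z w :: "'a \<Rightarrow>\<^sub>0 int"
    using keys_add[of z w] that by blast
  show ?thesis
  proof (rule cringI)
    show "abelian_group ?R"
    proof (rule abelian_groupI)
      fix x assume "x \<in> carrier ?R"
      then show "\<exists>y\<in>carrier ?R. y \<oplus>\<^bsub>?R\<^esub> x = \<zero>\<^bsub>?R\<^esub>"
        by (intro bexI[of _ "-x"]) (auto simp: carr)
    qed (auto simp: carr keys_plus ac_simps)
    show "comm_monoid ?R"
      by (rule comm_monoidI) (auto simp: carr closed assoc lone simp flip: m_def intro: comm)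
  qed (simp add: ladd' flip: m_def)
qed

end

theory Submission
  imports Defs
begin

text \<open>
  Two reductions turn composition into multiplication.  First, \<open>Fdeg f \<le> n\<close> means that all
  \<open>(n+1)\<close>-fold differences of \<open>f\<close> vanish.  Second, with \<open>P = \<Prod> B\<^sub>i\<close> and \<open>\<tau>\<^sub>i(a) \<in> \<int>[P]\<close> the
  basis element of \<open>f\<^sub>i(a)\<close> placed in the \<open>i\<close>-th coordinate, \<open>G(a) = ((\<Prod>\<^sub>i \<tau>\<^sub>i(a)) * g)(0)\<close>.
  By the Leibniz rule for differences of products in \<open>\<int>[P]\<close> it therefore suffices that the
  \<open>j\<close>-fold differences of \<open>\<tau>\<^sub>i\<close> kill \<open>g\<close> as soon as \<open>j > d e\<close>, where \<open>d = Fdeg f\<^sub>i\<close> and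
  \<open>e = Pdeg\<^sub>i g\<close>.

  Let \<open>I\<^sub>p\<close> be the ideal of elements killing every function of degree less than \<open>p\<close> in the \<open>i\<close>-th
  coordinate; then \<open>I\<^sub>p I\<^sub>q \<subseteq> I\<^sub>p\<^sub>+\<^sub>q\<close>.  If \<open>h\<close> has degree at most \<open>d\<close>, the \<open>j\<close>-fold
  differences of \<open>\<tau>\<^sub>h\<close> lie in \<open>I\<^sub>p\<close> for \<open>p = \<lceil>j/d\<rceil>\<close>.  This follows by induction on \<open>d\<close>, and
  on the number of differences, from \<open>\<Delta>\<^sub>a \<tau>\<^sub>h = \<tau>\<^sub>h (\<tau>\<^sub>h\<^sub>' - 1)\<close> with \<open>h' = \<Delta>\<^sub>a h\<close> of degree at
  most \<open>d - 1\<close>.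
\<close>

section \<open>Differences and the group ring action\<close>

definition fdiff ::
  "('a, 'm) monoid_scheme \<Rightarrow> ('c, 'n) monoid_scheme \<Rightarrow> 'a \<Rightarrow> ('a \<Rightarrow> 'c) \<Rightarrow> 'a \<Rightarrow> 'c" where
  "fdiff A C a f x = f (x \<otimes>\<^bsub>A\<^esub> a) \<otimes>\<^bsub>C\<^esub> inv\<^bsub>C\<^esub> f x"

text \<open>
  For \<open>S = carrier A\<close> this says \<open>Fdeg A C f < n\<close>, except that it forces \<open>f\<close> to be trivial when
  \<open>n = 0\<close>.  The image of one coordinate of a product as \<open>S\<close> gives the partial degree.
\<close>

primrec deg_less ::
  "('a, 'm) monoid_scheme \<Rightarrow> ('c, 'n) monoid_scheme \<Rightarrow> 'a set \<Rightarrow> nat \<Rightarrow> ('a \<Rightarrow> 'c) \<Rightarrow> bool" where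
  "deg_less A C S 0 f \<longleftrightarrow> (\<forall>x\<in>carrier A. f x = \<one>\<^bsub>C\<^esub>)"
| "deg_less A C S (Suc n) f \<longleftrightarrow> (\<forall>s\<in>S. deg_less A C S n (fdiff A C s f))"

locale comm_group_pair = A: comm_group A + C: comm_group C
  for A :: "('a, 'm) monoid_scheme" and C :: "('c, 'n) monoid_scheme"
begin

abbreviation "R \<equiv> int_group_ring A"
abbreviation "act \<equiv> group_ring_act A C"
abbreviation "Maps \<equiv> carrier A \<rightarrow> carrier C"

sublocale R: cring R
  by (rule cring_int_group_ring) (rule A.comm_group_axioms)

lemma carrier_R: "z \<in> carrier R \<longleftrightarrow> Poly_Mapping.keys z \<subseteq> carrier A"
  by (simp add: int_group_ring_def)

lemma add_R [simp]: "z \<oplus>\<^bsub>R\<^esub> w = z + w"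
  and zero_R [simp]: "\<zero>\<^bsub>R\<^esub> = 0"
  and one_R [simp]: "\<one>\<^bsub>R\<^esub> = frag_of \<one>\<^bsub>A\<^esub>"
  by (simp_all add: int_group_ring_def)

lemma a_inv_R [simp]:
  assumes "z \<in> carrier R" shows "\<ominus>\<^bsub>R\<^esub> z = - z"
  using assms by (intro R.sum_zero_eq_neg[symmetric]) (auto simp: carrier_R)

lemma minus_R [simp]:
  assumes "w \<in> carrier R" shows "z \<ominus>\<^bsub>R\<^esub> w = z - w"
  using assms by (simp add: a_minus_def)

lemma frag_of_closed [simp]: "frag_of a \<in> carrier R \<longleftrightarrow> a \<in> carrier A"
  by (simp add: carrier_R)

lemma frag_of_mult: "frag_of a \<otimes>\<^bsub>R\<^esub> frag_of b = frag_of (a \<otimes>\<^bsub>A\<^esub> b)"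
  by (simp add: int_group_ring_mult_extend)

lemma diff_closed: "z \<in> carrier R \<Longrightarrow> w \<in> carrier R \<Longrightarrow> z - w \<in> carrier R"
  using R.minus_closed[of z w] by simp

section \<open>The functions as a module over the group ring\<close>

lemma act_superset:
  assumes "f \<in> Maps" "x \<in> carrier A" "finite K" "Poly_Mapping.keys z \<subseteq> K" "K \<subseteq> carrier A"
  shows "act z f x = finprod C (\<lambda>a. f (x \<otimes>\<^bsub>A\<^esub> a) [^]\<^bsub>C\<^esub> Poly_Mapping.lookup z a) K"
  unfolding group_ring_act_def
proof (rule C.finprod_mono_neutral_cong_left)
  show "f (x \<otimes>\<^bsub>A\<^esub> a) [^]\<^bsub>C\<^esub> Poly_Mapping.lookup z a = \<one>\<^bsub>C\<^esub>" if "a \<in> K - Poly_Mapping.keys z" for a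
    using that by (simp add: in_keys_iff)
  show "(\<lambda>a. f (x \<otimes>\<^bsub>A\<^esub> a) [^]\<^bsub>C\<^esub> Poly_Mapping.lookup z a) \<in> K \<rightarrow> carrier C"
    using assms by (auto simp: Pi_iff subset_iff)
qed (use assms in auto)

lemma act_closed:
  assumes "f \<in> Maps" "x \<in> carrier A" "z \<in> carrier R"
  shows "act z f x \<in> carrier C"
  unfolding group_ring_act_def
  using assms by (intro C.finprod_closed) (auto simp: Pi_iff carrier_R subset_iff)

lemma act_Maps: "f \<in> Maps \<Longrightarrow> z \<in> carrier R \<Longrightarrow> act z f \<in> Maps"
  using act_closed by blast

lemma act_zero [simp]: "act 0 f x = \<one>\<^bsub>C\<^esub>"
  by (simp add: group_ring_act_def)

lemma act_frag_of:
  assumes "f \<in> Maps" "x \<in> carrier A" "a \<in> carrier A"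
  shows "act (frag_of a) f x = f (x \<otimes>\<^bsub>A\<^esub> a)"
  using assms by (simp add: group_ring_act_def Pi_iff)

lemma act_add:
  assumes "f \<in> Maps" "x \<in> carrier A" "z \<in> carrier R" "w \<in> carrier R"
  shows "act (z + w) f x = act z f x \<otimes>\<^bsub>C\<^esub> act w f x"
proof -
  define K where "K = Poly_Mapping.keys z \<union> Poly_Mapping.keys w"
  have K: "finite K" "K \<subseteq> carrier A" "Poly_Mapping.keys z \<subseteq> K" "Poly_Mapping.keys w \<subseteq> K"
    "Poly_Mapping.keys (z + w) \<subseteq> K"
    using assms keys_add[of z w] by (auto simp: K_def carrier_R)
  have f: "f (x \<otimes>\<^bsub>A\<^esub> a) \<in> carrier C" if "a \<in> K" for a
    using assms K that by (auto simp: Pi_iff subset_iff)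
  have "act (z + w) f x = finprod C (\<lambda>a. f (x \<otimes>\<^bsub>A\<^esub> a) [^]\<^bsub>C\<^esub> Poly_Mapping.lookup z a \<otimes>\<^bsub>C\<^esub>
      f (x \<otimes>\<^bsub>A\<^esub> a) [^]\<^bsub>C\<^esub> Poly_Mapping.lookup w a) K"
    unfolding act_superset[OF assms(1,2) K(1,5,2)]
    by (rule C.finprod_cong') (use f in \<open>auto simp: lookup_add C.int_pow_mult\<close>)
  also have "\<dots> = act z f x \<otimes>\<^bsub>C\<^esub> act w f x"
    unfolding act_superset[OF assms(1,2) K(1,3,2)] act_superset[OF assms(1,2) K(1,4,2)]
    by (rule C.finprod_multf) (use f in auto)
  finally show ?thesis .
qed

lemma act_diff:
  assumes "f \<in> Maps" "x \<in> carrier A" "z \<in> carrier R" "w \<in> carrier R"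
  shows "act (z - w) f x = act z f x \<otimes>\<^bsub>C\<^esub> inv\<^bsub>C\<^esub> act w f x"
proof -
  have "act (z - w + w) f x = act (z - w) f x \<otimes>\<^bsub>C\<^esub> act w f x"
    using assms by (intro act_add diff_closed)
  then show ?thesis
    using assms by (simp add: act_closed diff_closed C.inv_solve_right)
qed

lemma act_cong:
  assumes "\<And>y. y \<in> carrier A \<Longrightarrow> f y = f' y" "f' \<in> Maps" "x \<in> carrier A" "z \<in> carrier R"
  shows "act z f x = act z f' x"
  unfolding group_ring_act_def
  using assms by (intro C.finprod_cong') (auto simp: Pi_iff carrier_R subset_iff)

lemma act_one:
  assumes "\<And>y. y \<in> carrier A \<Longrightarrow> f y = \<one>\<^bsub>C\<^esub>" "x \<in> carrier A" "z \<in> carrier R"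
  shows "act z f x = \<one>\<^bsub>C\<^esub>"
  unfolding group_ring_act_def
  using assms by (intro C.finprod_one_eqI) (auto simp: carrier_R subset_iff)

text \<open>The product and the action are additive in ring elements, so their identities need
  checking only on basis elements. Membership in \<open>R\<close> is carried along because the
  lemmas on \<open>act\<close> require it.\<close>

lemma R_induct [consumes 1, case_names zero of diff]:
  assumes "z \<in> carrier R" "Q 0" "\<And>a. a \<in> carrier A \<Longrightarrow> Q (frag_of a)"
    "\<And>z w. z \<in> carrier R \<Longrightarrow> w \<in> carrier R \<Longrightarrow> Q z \<Longrightarrow> Q w \<Longrightarrow> Q (z - w)"
  shows "Q z"
proof -
  have "z \<in> carrier R \<and> Q z"
    using assms(1)[unfolded carrier_R]
    by (induction rule: frag_induction) (use assms(2-) diff_closed R.zero_closed in auto)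
  then show ?thesis ..
qed

lemma diff_mult:
  assumes "z \<in> carrier R" "w \<in> carrier R" "v \<in> carrier R"
  shows "(z - w) \<otimes>\<^bsub>R\<^esub> v = z \<otimes>\<^bsub>R\<^esub> v - w \<otimes>\<^bsub>R\<^esub> v" "v \<otimes>\<^bsub>R\<^esub> (z - w) = v \<otimes>\<^bsub>R\<^esub> z - v \<otimes>\<^bsub>R\<^esub> w"
  using R.minus_closed[of z w] R.l_distr[of "z - w" w v] R.r_distr[of "z - w" w v] assms
  by (auto simp: algebra_simps)

lemma act_diff_arg:
  assumes "f \<in> Maps" "h \<in> Maps" "x \<in> carrier A" "z \<in> carrier R"
  shows "act z (\<lambda>y. f y \<otimes>\<^bsub>C\<^esub> inv\<^bsub>C\<^esub> h y) x = act z f x \<otimes>\<^bsub>C\<^esub> inv\<^bsub>C\<^esub> act z h x"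
  using assms(4)
proof (induction rule: R_induct)
  case (of a)
  then show ?case using assms by (subst (1 2 3) act_frag_of) (auto simp: Pi_iff)
next
  case (diff z w)
  have [simp]: "(\<lambda>y. f y \<otimes>\<^bsub>C\<^esub> inv\<^bsub>C\<^esub> h y) \<in> Maps"
    using assms by (auto simp: Pi_iff)
  show ?case
    using assms diff by (simp add: act_diff act_closed C.inv_mult C.m_ac)
qed simp

text \<open>Both sides are additive in \<open>z\<close> and, for a basis element \<open>z\<close>,
  in \<open>w\<close>; on two basis elements the claim is associativity in \<open>A\<close>.\<close>

lemma act_mult:
  assumes "f \<in> Maps" "x \<in> carrier A" "z \<in> carrier R" "w \<in> carrier R"
  shows "act (z \<otimes>\<^bsub>R\<^esub> w) f x = act z (act w f) x"
  using assms(3)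
proof (induction rule: R_induct)
  case zero
  then show ?case using assms R.l_null[of w] by simp
next
  case (diff z v)
  then show ?case using assms by (simp add: diff_mult act_diff act_Maps)
next
  case (of a)
  have "act (frag_of a \<otimes>\<^bsub>R\<^esub> w) f x = act w f (x \<otimes>\<^bsub>A\<^esub> a)"
    using assms(4)
  proof (induction rule: R_induct)
    case zero
    then show ?case using of R.r_null[of "frag_of a"] by simp
  next
    case (of b)
    then show ?case
      using assms \<open>a \<in> carrier A\<close> by (simp add: frag_of_mult act_frag_of A.m_assoc)
  next
    case (diff z v)
    then show ?case using assms of by (simp add: diff_mult act_diff)
  qed
  then show ?case
    using assms of by (simp add: act_frag_of act_Maps)
qed

section \<open>Differences as ring operators, and annihilators of functions of small degree\<close>

lemma fdiff_Maps: "f \<in> Maps \<Longrightarrow> s \<in> carrier A \<Longrightarrow> fdiff A C s f \<in> Maps"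
  by (auto simp: fdiff_def Pi_iff)

lemma fdiff_closed:
  "f \<in> Maps \<Longrightarrow> s \<in> carrier A \<Longrightarrow> x \<in> carrier A \<Longrightarrow> fdiff A C s f x \<in> carrier C"
  using fdiff_Maps by blast

text \<open>Translation by \<open>s\<close> is the action of \<open>frag_of s\<close>, which
  commutes with \<open>z\<close> because \<open>R\<close> is commutative.\<close>

lemma act_fdiff:
  assumes "f \<in> Maps" "s \<in> carrier A" "x \<in> carrier A" "z \<in> carrier R"
  shows "act z (fdiff A C s f) x = fdiff A C s (act z f) x"
proof -
  have "act z (act (frag_of s) f) x = act (frag_of s) (act z f) x"
    using assms by (simp flip: act_mult add: R.m_comm)
  moreover have "act z (act (frag_of s) f) x = act z (\<lambda>y. f (y \<otimes>\<^bsub>A\<^esub> s)) x"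
    using assms by (intro act_cong) (auto simp: act_frag_of Pi_iff)
  ultimately have "act z (\<lambda>y. f (y \<otimes>\<^bsub>A\<^esub> s)) x = act z f (x \<otimes>\<^bsub>A\<^esub> s)"
    using assms by (simp add: act_frag_of act_Maps)
  then show ?thesis
    unfolding fdiff_def using assms by (subst act_diff_arg) (auto simp: Pi_iff)
qed

lemma act_frag_diff:
  assumes "f \<in> Maps" "s \<in> carrier A" "x \<in> carrier A"
  shows "act (frag_of s - frag_of \<one>\<^bsub>A\<^esub>) f x = fdiff A C s f x"
  using assms by (simp add: act_diff act_frag_of fdiff_def)

lemma deg_less_cong:
  assumes "\<And>x. x \<in> carrier A \<Longrightarrow> f x = h x" "S \<subseteq> carrier A"
  shows "deg_less A C S n f \<longleftrightarrow> deg_less A C S n h"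
  using assms(1)
proof (induction n arbitrary: f h)
  case (Suc n)
  have "deg_less A C S n (fdiff A C s f) \<longleftrightarrow> deg_less A C S n (fdiff A C s h)" if "s \<in> S" for s
    using that assms(2) Suc.prems by (intro Suc.IH) (auto simp: fdiff_def)
  then show ?case by simp
qed simp

text \<open>These are the ideals \<open>I\<^sub>p\<close> of the overview, for a general set
  \<open>S\<close> of directions. Quantifying over all functions of small degree is what makes them
  multiply in \<open>Ann_mult\<close>: there \<open>z\<close> must kill the new function
  \<open>act w f\<close>.\<close>

definition Ann :: "'a set \<Rightarrow> nat \<Rightarrow> ('a \<Rightarrow>\<^sub>0 int) set" where
  "Ann S n = {z \<in> carrier R. \<forall>f\<in>Maps. deg_less A C S n f \<longrightarrow> (\<forall>x\<in>carrier A. act z f x = \<one>\<^bsub>C\<^esub>)}"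

text \<open>Annihilators in a module over a commutative ring are ideals. The set \<open>F\<close> is
  later either all functions of bounded degree or a single function \<open>g\<close>.\<close>

lemma ideal_act_eq_one:
  assumes F: "F \<subseteq> Maps"
  shows "ideal {z \<in> carrier R. \<forall>f\<in>F. \<forall>x\<in>carrier A. act z f x = \<one>\<^bsub>C\<^esub>} R" (is "ideal ?I R")
proof (rule idealI)
  show "ring R" by (rule R.ring_axioms)
  have inv_closed: "- z \<in> ?I" if "z \<in> ?I" for z
    using that F act_diff[of _ _ 0 z] R.zero_closed R.a_inv_closed[of z] by (auto simp: subset_iff)
  have add_closed: "z + w \<in> ?I" if "z \<in> ?I" "w \<in> ?I" for z w
    using that F R.add.m_closed[of z w] by (auto simp: act_add subset_iff)
  show "subgroup ?I (add_monoid R)"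
  proof (rule subgroup.intro)
    show "inv\<^bsub>add_monoid R\<^esub> z \<in> ?I" if "z \<in> ?I" for z
      using inv_closed[OF that] a_inv_R[of z] that by (simp add: a_inv_def)
    show "\<one>\<^bsub>add_monoid R\<^esub> \<in> ?I" using R.zero_closed by simp
  qed (use add_closed in auto)
  show 1: "w \<otimes>\<^bsub>R\<^esub> z \<in> ?I" if "z \<in> ?I" "w \<in> carrier R" for z w
    using that F by (auto simp: subset_iff act_mult act_one[of "act z _"])
  show "z \<otimes>\<^bsub>R\<^esub> w \<in> ?I" if "z \<in> ?I" "w \<in> carrier R" for z w
    using 1[OF that] that by (simp add: R.m_comm)
qed

lemma ideal_Ann: "ideal (Ann S n) R"
proof -
  have "Ann S n = {z \<in> carrier R. \<forall>f\<in>{f\<in>Maps. deg_less A C S n f}. \<forall>x\<in>carrier A. act z f x = \<one>\<^bsub>C\<^esub>}"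
    by (auto simp: Ann_def)
  also have "ideal \<dots> R" by (rule ideal_act_eq_one) auto
  finally show ?thesis .
qed

lemma Ann_0: "Ann S 0 = carrier R"
  by (auto simp: Ann_def intro: act_one)

text \<open>Differences commute with the action, so \<open>p\<close> of them can be moved onto
  \<open>f\<close>. This leaves a function of degree less than \<open>q\<close>, which
  \<open>w\<close> kills.\<close>

lemma deg_less_act:
  assumes "deg_less A C S (p + q) f" "f \<in> Maps" "w \<in> Ann S q" "S \<subseteq> carrier A"
  shows "deg_less A C S p (act w f)"
  using assms(1,2)
proof (induction p arbitrary: f)
  case 0
  then show ?case using assms by (auto simp: Ann_def)
next
  case (Suc p)
  have "deg_less A C S p (fdiff A C s (act w f))" if s: "s \<in> S" for s
  proof -
    have "deg_less A C S p (act w (fdiff A C s f))"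
      using Suc s assms(4) by (auto intro!: Suc.IH fdiff_closed)
    then show ?thesis
      using Suc.prems s assms by (subst deg_less_cong[where h = "act w (fdiff A C s f)"])
        (auto simp: act_fdiff Ann_def subset_iff)
  qed
  then show ?case by simp
qed

lemma Ann_mult:
  assumes "z \<in> Ann S p" "w \<in> Ann S q" "S \<subseteq> carrier A"
  shows "z \<otimes>\<^bsub>R\<^esub> w \<in> Ann S (p + q)"
proof -
  have R: "z \<in> carrier R" "w \<in> carrier R" using assms by (auto simp: Ann_def)
  moreover have "act (z \<otimes>\<^bsub>R\<^esub> w) f x = \<one>\<^bsub>C\<^esub>"
    if "f \<in> Maps" "deg_less A C S (p + q) f" "x \<in> carrier A" for f x
    using that R assms deg_less_act[OF that(2,1) assms(2,3)] act_Maps[OF that(1) R(2)]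
    by (auto simp: act_mult Ann_def)
  ultimately show ?thesis by (simp add: Ann_def)
qed

lemma frag_diff_Ann:
  assumes "s \<in> S" "S \<subseteq> carrier A"
  shows "frag_of s - frag_of \<one>\<^bsub>A\<^esub> \<in> Ann S 1"
  using assms by (auto simp: Ann_def act_frag_diff diff_closed subset_iff)

section \<open>Functional degree expressed by iterated differences\<close>

lemma frag_diff_aug: "a \<in> carrier A \<Longrightarrow> frag_of a - frag_of \<one>\<^bsub>A\<^esub> \<in> aug_ideal A"
  unfolding aug_ideal_def
  by (rule subsetD[OF R.genideal_self]) (auto simp: diff_closed)

lemma aug_ideal_le_Ann: "aug_ideal A \<subseteq> Ann (carrier A) 1"
  unfolding aug_ideal_def
  by (rule R.genideal_minimal) (use ideal_Ann frag_diff_Ann in auto)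

lemma aug_ideal_carrier: "aug_ideal A \<subseteq> carrier R"
  using aug_ideal_le_Ann by (auto simp: Ann_def)

lemma finprod_aug_Ann:
  assumes "u \<in> {1..n} \<rightarrow> aug_ideal A"
  shows "finprod R u {1..n} \<in> Ann (carrier A) n"
  using assms
proof (induction n)
  case 0
  then show ?case using R.one_closed by (simp add: Ann_0)
next
  case (Suc n)
  have u: "u \<in> {1..n} \<rightarrow> carrier R" "u (Suc n) \<in> Ann (carrier A) 1" "u (Suc n) \<in> carrier R"
    using Suc.prems aug_ideal_carrier aug_ideal_le_Ann by (force simp: Pi_iff)+
  have "finprod R u {1..Suc n} = u (Suc n) \<otimes>\<^bsub>R\<^esub> finprod R u {1..n}"
    using u by (simp add: atLeastAtMostSuc_conv R.finprod_insert)
  also have "\<dots> \<in> Ann (carrier A) (1 + n)"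
    using Suc u by (intro Ann_mult) (auto simp: Pi_iff)
  finally show ?case by simp
qed

lemma annihilates_if_deg_less:
  assumes "deg_less A C (carrier A) (Suc n) f" "f \<in> Maps"
  shows "annihilates A C (ideal_power R (aug_ideal A) (Suc n)) f"
proof -
  have "ideal_power R (aug_ideal A) (Suc n) \<subseteq> Ann (carrier A) (Suc n)"
    unfolding ideal_power_def if_not_P[OF nat.distinct(2)]
    by (rule R.genideal_minimal) (use finprod_aug_Ann ideal_Ann in blast)+
  then show ?thesis
    using assms by (auto simp: annihilates_def Ann_def)
qed

text \<open>The elements \<open>frag_of s - frag_of \<one>\<close> of the augmentation ideal act as
  difference operators, so the \<open>n\<close>-fold differences are among the given
  products.\<close>

lemma deg_less_if_finprod:
  assumes "\<And>u x. u \<in> {1..n} \<rightarrow> aug_ideal A \<Longrightarrow> x \<in> carrier A \<Longrightarrow> act (finprod R u {1..n}) f x = \<one>\<^bsub>C\<^esub>"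
    "f \<in> Maps"
  shows "deg_less A C (carrier A) n f"
  using assms
proof (induction n arbitrary: f)
  case 0
  then show ?case by (auto simp: act_frag_of)
next
  case (Suc n)
  have "deg_less A C (carrier A) n (fdiff A C s f)" if s: "s \<in> carrier A" for s
  proof (rule Suc.IH)
    fix u :: "nat \<Rightarrow> ('a \<Rightarrow>\<^sub>0 int)" and x assume u: "u \<in> {1..n} \<rightarrow> aug_ideal A" and x: "x \<in> carrier A"
    define t where "t = frag_of s - frag_of \<one>\<^bsub>A\<^esub>"
    \<comment> \<open>Appending \<open>t\<close> as last factor turns the assumption on
      \<open>f\<close> with \<open>n + 1\<close> factors into the one on
      \<open>fdiff A C s f\<close> with \<open>n\<close> factors.\<close>
    define u' where "u' = u(Suc n := t)"
    have t: "t \<in> aug_ideal A" "t \<in> carrier R"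
      using s frag_diff_aug aug_ideal_carrier by (auto simp: t_def)
    have uR: "u \<in> {1..n} \<rightarrow> carrier R" using u aug_ideal_carrier by auto
    have "finprod R u' {1..Suc n} = t \<otimes>\<^bsub>R\<^esub> finprod R u' {1..n}"
      using uR t by (simp add: atLeastAtMostSuc_conv u'_def R.finprod_insert Pi_iff)
    also have "finprod R u' {1..n} = finprod R u {1..n}"
      using uR by (intro R.finprod_cong') (auto simp: u'_def)
    finally have "finprod R u' {1..Suc n} = finprod R u {1..n} \<otimes>\<^bsub>R\<^esub> t"
      using t uR by (simp add: R.m_comm)
    moreover have "act (finprod R u' {1..Suc n}) f x = \<one>\<^bsub>C\<^esub>"
      using u t x by (intro Suc.prems) (auto simp: u'_def Pi_iff)
    moreover have "act (finprod R u {1..n}) (act t f) x = act (finprod R u {1..n}) (fdiff A C s f) x"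
      unfolding t_def using x s Suc.prems uR
      by (intro act_cong) (auto simp: act_frag_diff fdiff_closed R.finprod_closed)
    ultimately show "act (finprod R u {1..n}) (fdiff A C s f) x = \<one>\<^bsub>C\<^esub>"
      using x t uR Suc.prems by (simp add: act_mult)
  qed (rule fdiff_Maps[OF Suc.prems(2) s])
  then show ?case by simp
qed

lemma deg_less_if_annihilates:
  assumes "annihilates A C (ideal_power R (aug_ideal A) (Suc n)) f" "f \<in> Maps"
  shows "deg_less A C (carrier A) (Suc n) f"
proof (rule deg_less_if_finprod)
  fix u x assume u: "u \<in> {1..Suc n} \<rightarrow> aug_ideal A" and x: "x \<in> carrier A"
  have "finprod R u {1..Suc n} \<in> ideal_power R (aug_ideal A) (Suc n)"
    unfolding ideal_power_def if_not_P[OF nat.distinct(2)]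
    by (rule subsetD[OF R.genideal_self]) (use u aug_ideal_carrier in \<open>auto intro!: R.finprod_closed\<close>)
  then show "act (finprod R u {1..Suc n}) f x = \<one>\<^bsub>C\<^esub>"
    using assms x by (simp add: annihilates_def)
qed (rule assms)

lemma deg_less_one_const:
  assumes "deg_less A C S (Suc 0) f" "f \<in> Maps" "x \<in> carrier A" "s \<in> S" "S \<subseteq> carrier A"
  shows "f (x \<otimes>\<^bsub>A\<^esub> s) = f x"
proof -
  have "f x \<in> carrier C" "f (x \<otimes>\<^bsub>A\<^esub> s) \<in> carrier C" using assms by (auto simp: Pi_iff)
  moreover have "f (x \<otimes>\<^bsub>A\<^esub> s) \<otimes>\<^bsub>C\<^esub> inv\<^bsub>C\<^esub> f x = \<one>\<^bsub>C\<^esub>" using assms by (simp add: fdiff_def)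
  ultimately show ?thesis using C.inv_solve_right' by fastforce
qed

lemma deg_less_mono:
  assumes "deg_less A C S n f" "n \<le> m" "S \<subseteq> carrier A"
  shows "deg_less A C S m f"
proof -
  have step: "deg_less A C S (Suc n) f" if "deg_less A C S n f" for n f
    using that
  proof (induction n arbitrary: f)
    case 0
    then show ?case using assms(3) by (auto simp: fdiff_def subset_iff)
  qed simp
  show ?thesis using assms(2,1) by (induction rule: dec_induct) (blast intro: step)+
qed

text \<open>The offset comes from \<open>Fdeg\<close>, where degree \<open>n\<close> refers to the
  ideal power \<open>n + 1\<close>. Monotonicity of \<open>deg_less\<close> passes from the least
  exponent to any larger one.\<close>

lemma Fdeg_le_iff:
  assumes "f \<in> Maps"
  shows "Fdeg A C f \<le> enat n \<longleftrightarrow> deg_less A C (carrier A) (Suc n) f"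
proof
  let ?Q = "\<lambda>n. annihilates A C (ideal_power R (aug_ideal A) (Suc n)) f"
  assume L: "Fdeg A C f \<le> enat n"
  then have "\<exists>n. ?Q n" by (auto simp: Fdeg_def split: if_splits)
  then have "?Q (LEAST n. ?Q n)" by (rule LeastI_ex)
  moreover have "(LEAST n. ?Q n) \<le> n"
    using L \<open>\<exists>n. ?Q n\<close> by (auto simp: Fdeg_def)
  ultimately show "deg_less A C (carrier A) (Suc n) f"
    using deg_less_if_annihilates[OF _ assms] deg_less_mono[of "carrier A"] by blast
next
  assume "deg_less A C (carrier A) (Suc n) f"
  then show "Fdeg A C f \<le> enat n"
    using annihilates_if_deg_less[OF _ assms] by (auto simp: Fdeg_def intro: Least_le)
qed

end

section \<open>Filtered maps into a ring\<close>

text \<open>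
  \<open>filt A R n W u\<close>: for all \<open>i \<le> n\<close>, the \<open>i\<close>-fold differences of \<open>u\<close> take values in \<open>W i\<close>.  The
  bound \<open>n\<close> permits induction through \<open>\<Delta>\<^sub>a \<tau>\<^sub>h = \<tau>\<^sub>h (\<tau>\<^sub>h\<^sub>' - 1)\<close>, where \<open>\<tau>\<^sub>h\<close> recurs on the right.
\<close>

primrec filt ::
  "('a, 'm) monoid_scheme \<Rightarrow> ('r, 'n) ring_scheme \<Rightarrow> nat \<Rightarrow> (nat \<Rightarrow> 'r set) \<Rightarrow> ('a \<Rightarrow> 'r) \<Rightarrow> bool" where
  "filt A R 0 W u \<longleftrightarrow> (\<forall>x\<in>carrier A. u x \<in> W 0)"
| "filt A R (Suc n) W u \<longleftrightarrow> (\<forall>x\<in>carrier A. u x \<in> W 0) \<and>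
     (\<forall>a\<in>carrier A. filt A R n (\<lambda>i. W (Suc i)) (\<lambda>x. u (x \<otimes>\<^bsub>A\<^esub> a) \<ominus>\<^bsub>R\<^esub> u x))"

locale filtered_maps = A: comm_group A + R: cring R
  for A :: "('a, 'm) monoid_scheme" and R :: "('r, 'n) ring_scheme"
begin

abbreviation "filtered \<equiv> filt A R"

lemma filt_cong:
  assumes "\<And>x. x \<in> carrier A \<Longrightarrow> u x = v x"
  shows "filtered n W u \<longleftrightarrow> filtered n W v"
  using assms
proof (induction n arbitrary: u v W)
  case (Suc n)
  have "filtered n (\<lambda>i. W (Suc i)) (\<lambda>x. u (x \<otimes>\<^bsub>A\<^esub> a) \<ominus>\<^bsub>R\<^esub> u x) \<longleftrightarrow>
      filtered n (\<lambda>i. W (Suc i)) (\<lambda>x. v (x \<otimes>\<^bsub>A\<^esub> a) \<ominus>\<^bsub>R\<^esub> v x)" if "a \<in> carrier A" for a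
    using that Suc.prems by (intro Suc.IH) auto
  then show ?case using Suc.prems by simp
qed simp

lemma filt_mono:
  assumes "filtered n W u" "\<And>i. W i \<subseteq> V i"
  shows "filtered n V u"
  using assms
proof (induction n arbitrary: u W V)
  case (Suc n)
  have "filtered n (\<lambda>i. V (Suc i)) (\<lambda>x. u (x \<otimes>\<^bsub>A\<^esub> a) \<ominus>\<^bsub>R\<^esub> u x)" if "a \<in> carrier A" for a
    by (rule Suc.IH[of "\<lambda>i. W (Suc i)"]) (use that Suc.prems in auto)
  then show ?case using Suc.prems by (auto simp: subset_iff)
qed auto

lemma filt_SucD: "filtered (Suc n) W u \<Longrightarrow> filtered n W u"
proof (induction n arbitrary: u W)
  case (Suc n)
  have "filtered n (\<lambda>i. W (Suc i)) (\<lambda>x. u (x \<otimes>\<^bsub>A\<^esub> a) \<ominus>\<^bsub>R\<^esub> u x)" if "a \<in> carrier A" for a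
    by (rule Suc.IH) (use that Suc.prems in simp)
  then show ?case using Suc.prems by simp
qed simp

lemma filt_0D: "filtered n W u \<Longrightarrow> x \<in> carrier A \<Longrightarrow> u x \<in> W 0"
  by (cases n) auto

lemma filt_ideal:
  assumes "\<And>x. x \<in> carrier A \<Longrightarrow> u x \<in> K" "ideal K R" "\<And>i. K \<subseteq> W i"
  shows "filtered n W u"
  using assms(1,3)
proof (induction n arbitrary: u W)
  case (Suc n)
  interpret K: ideal K R by fact
  have "filtered n (\<lambda>i. W (Suc i)) (\<lambda>x. u (x \<otimes>\<^bsub>A\<^esub> a) \<ominus>\<^bsub>R\<^esub> u x)" if "a \<in> carrier A" for a
    using that Suc.prems by (intro Suc.IH) (auto simp: a_minus_def)
  then show ?case using Suc.prems by (auto simp: subset_iff)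
qed auto

text \<open>If \<open>u\<close> is constant modulo the ideal \<open>K\<close>, all its differences
  of positive order stay in \<open>K\<close>, so beyond that only the values of \<open>u\<close>
  need checking.\<close>

lemma filt_const_mod:
  assumes "\<And>x a. x \<in> carrier A \<Longrightarrow> a \<in> carrier A \<Longrightarrow> u (x \<otimes>\<^bsub>A\<^esub> a) \<ominus>\<^bsub>R\<^esub> u x \<in> K"
    and "\<And>x. x \<in> carrier A \<Longrightarrow> u x \<in> W 0" "ideal K R" "\<And>i. K \<subseteq> W (Suc i)"
  shows "filtered n W u"
  using assms by (cases n) (auto intro!: filt_ideal[of _ K] simp: subset_iff)

lemma filt_add:
  assumes "filtered n W u" "filtered n W v"
    and "\<And>i. W i \<subseteq> carrier R" "\<And>i z w. z \<in> W i \<Longrightarrow> w \<in> W i \<Longrightarrow> z \<oplus>\<^bsub>R\<^esub> w \<in> W i"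
  shows "filtered n W (\<lambda>x. u x \<oplus>\<^bsub>R\<^esub> v x)"
  using assms
proof (induction n arbitrary: u v W)
  case (Suc n)
  have "filtered n (\<lambda>i. W (Suc i)) (\<lambda>x. (u (x \<otimes>\<^bsub>A\<^esub> a) \<oplus>\<^bsub>R\<^esub> v (x \<otimes>\<^bsub>A\<^esub> a)) \<ominus>\<^bsub>R\<^esub> (u x \<oplus>\<^bsub>R\<^esub> v x))"
    if a: "a \<in> carrier A" for a
  proof -
    have "filtered n (\<lambda>i. W (Suc i))
        (\<lambda>x. (u (x \<otimes>\<^bsub>A\<^esub> a) \<ominus>\<^bsub>R\<^esub> u x) \<oplus>\<^bsub>R\<^esub> (v (x \<otimes>\<^bsub>A\<^esub> a) \<ominus>\<^bsub>R\<^esub> v x))"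
      using a Suc.prems by (intro Suc.IH) auto
    moreover have "(u (x \<otimes>\<^bsub>A\<^esub> a) \<oplus>\<^bsub>R\<^esub> v (x \<otimes>\<^bsub>A\<^esub> a)) \<ominus>\<^bsub>R\<^esub> (u x \<oplus>\<^bsub>R\<^esub> v x) =
        (u (x \<otimes>\<^bsub>A\<^esub> a) \<ominus>\<^bsub>R\<^esub> u x) \<oplus>\<^bsub>R\<^esub> (v (x \<otimes>\<^bsub>A\<^esub> a) \<ominus>\<^bsub>R\<^esub> v x)" if x: "x \<in> carrier A" for x
    proof -
      have "u y \<in> carrier R \<and> v y \<in> carrier R" if "y \<in> carrier A" for y
        using Suc.prems that by (auto simp: subset_iff)
      from this[of x] this[of "x \<otimes>\<^bsub>A\<^esub> a"] show ?thesis
        using x a by (simp add: a_minus_def R.minus_add R.a_ac)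
    qed
    ultimately show ?thesis by (subst filt_cong) auto
  qed
  then show ?case using Suc.prems by auto
qed auto

text \<open>This is the Leibniz rule for finite differences, with its extra term. The undifferenced
  factors appear untranslated, so the hypotheses on \<open>u\<close> and \<open>v\<close> apply to
  them directly.\<close>

lemma diff_mult_decomp:
  assumes "u \<in> carrier R" "v \<in> carrier R" "u' \<in> carrier R" "v' \<in> carrier R"
  shows "u' \<otimes>\<^bsub>R\<^esub> v' \<ominus>\<^bsub>R\<^esub> u \<otimes>\<^bsub>R\<^esub> v = (u' \<ominus>\<^bsub>R\<^esub> u) \<otimes>\<^bsub>R\<^esub> v \<oplus>\<^bsub>R\<^esub>
    (u \<otimes>\<^bsub>R\<^esub> (v' \<ominus>\<^bsub>R\<^esub> v) \<oplus>\<^bsub>R\<^esub> (u' \<ominus>\<^bsub>R\<^esub> u) \<otimes>\<^bsub>R\<^esub> (v' \<ominus>\<^bsub>R\<^esub> v))"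
  using assms by algebra

text \<open>In each of the three Leibniz terms at least one factor is differenced, which shifts its
  filtration by one; \<open>filt_SucD\<close> cuts an undifferenced factor down to the bound
  \<open>n\<close>.\<close>

lemma filt_mult:
  assumes "filtered n W u" "filtered n V v"
    and "\<And>i. W i \<subseteq> carrier R" "\<And>i. V i \<subseteq> carrier R" "\<And>i. Y i \<subseteq> carrier R" "\<And>i. Y (Suc i) \<subseteq> Y i"
    and "\<And>i z w. z \<in> Y i \<Longrightarrow> w \<in> Y i \<Longrightarrow> z \<oplus>\<^bsub>R\<^esub> w \<in> Y i"
    and "\<And>i j z w. z \<in> W i \<Longrightarrow> w \<in> V j \<Longrightarrow> z \<otimes>\<^bsub>R\<^esub> w \<in> Y (i + j)"
  shows "filtered n Y (\<lambda>x. u x \<otimes>\<^bsub>R\<^esub> v x)"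
  using assms
proof (induction n arbitrary: u v W V Y)
  case 0
  then show ?case using 0(8)[of _ 0 _ 0] by simp
next
  case (Suc n)
  note prem = Suc.prems
  have "filtered n (\<lambda>i. Y (Suc i)) (\<lambda>x. u (x \<otimes>\<^bsub>A\<^esub> a) \<otimes>\<^bsub>R\<^esub> v (x \<otimes>\<^bsub>A\<^esub> a) \<ominus>\<^bsub>R\<^esub> u x \<otimes>\<^bsub>R\<^esub> v x)"
    if a: "a \<in> carrier A" for a
  proof -
    let ?du = "\<lambda>x. u (x \<otimes>\<^bsub>A\<^esub> a) \<ominus>\<^bsub>R\<^esub> u x" and ?dv = "\<lambda>x. v (x \<otimes>\<^bsub>A\<^esub> a) \<ominus>\<^bsub>R\<^esub> v x"
    note F = filt_SucD[OF prem(1)] filt_SucD[OF prem(2)]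
    have D: "filtered n (\<lambda>i. W (Suc i)) ?du" "filtered n (\<lambda>i. V (Suc i)) ?dv"
      using prem(1,2) a by auto
    \<comment> \<open>With both factors differenced the product lies one step deeper than required,
      and \<open>Y\<close> is decreasing.\<close>
    have mono: "z \<otimes>\<^bsub>R\<^esub> w \<in> Y (Suc (i + j))" if "z \<in> W (Suc i)" "w \<in> V (Suc j)" for z w i j
      using prem(8)[OF that] prem(6)[of "Suc (i + j)"] by auto
    have 1: "filtered n (\<lambda>i. Y (Suc i)) (\<lambda>x. ?du x \<otimes>\<^bsub>R\<^esub> v x)"
      by (rule Suc.IH[OF D(1) F(2)]) (use prem(3-7) prem(8)[of _ "Suc _"] in auto)
    have 2: "filtered n (\<lambda>i. Y (Suc i)) (\<lambda>x. u x \<otimes>\<^bsub>R\<^esub> ?dv x)"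
      by (rule Suc.IH[OF F(1) D(2)]) (use prem(3-7) prem(8)[of _ _ _ "Suc _"] in auto)
    have 3: "filtered n (\<lambda>i. Y (Suc i)) (\<lambda>x. ?du x \<otimes>\<^bsub>R\<^esub> ?dv x)"
      by (rule Suc.IH[OF D]) (use prem(3-7) mono in auto)
    have "filtered n (\<lambda>i. Y (Suc i))
        (\<lambda>x. ?du x \<otimes>\<^bsub>R\<^esub> v x \<oplus>\<^bsub>R\<^esub> (u x \<otimes>\<^bsub>R\<^esub> ?dv x \<oplus>\<^bsub>R\<^esub> ?du x \<otimes>\<^bsub>R\<^esub> ?dv x))"
      by (intro filt_add 1 2 3 prem(5,7))
    moreover have "u x \<in> carrier R \<and> v x \<in> carrier R" if "x \<in> carrier A" for x
      using that filt_0D[OF prem(1)] filt_0D[OF prem(2)] prem(3,4) by blast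
    ultimately show ?thesis
      using a by (subst filt_cong) (auto intro!: diff_mult_decomp)
  qed
  then show ?case using prem(8)[of _ 0 _ 0] prem(1,2) by simp
qed

text \<open>An additive \<psi> carries differences in \<open>R\<close> to differences in
  \<open>C\<close>, so the \<open>n\<close>-fold differences are values of \<psi> on
  \<open>W n\<close>.\<close>

lemma deg_less_if_filt:
  assumes "filtered n W u" "\<And>i. W i \<subseteq> carrier R" "comm_group C"
    and "\<And>z w. z \<in> carrier R \<Longrightarrow> w \<in> carrier R \<Longrightarrow> \<psi> (z \<ominus>\<^bsub>R\<^esub> w) = \<psi> z \<otimes>\<^bsub>C\<^esub> inv\<^bsub>C\<^esub> \<psi> w"
    and "\<And>z. z \<in> W n \<Longrightarrow> \<psi> z = \<one>\<^bsub>C\<^esub>"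
  shows "deg_less A C (carrier A) n (\<lambda>x. \<psi> (u x))"
  using assms(1,2,5)
proof (induction n arbitrary: u W)
  case (Suc n)
  interpret AC: comm_group_pair A C
    using A.comm_group_axioms assms(3) by (simp add: comm_group_pair_def)
  have "deg_less A C (carrier A) n (fdiff A C a (\<lambda>x. \<psi> (u x)))" if a: "a \<in> carrier A" for a
  proof -
    have "u x \<in> carrier R" if "x \<in> carrier A" for x
      using filt_0D[OF Suc.prems(1)] that Suc.prems(2) by blast
    then have "fdiff A C a (\<lambda>x. \<psi> (u x)) x = \<psi> (u (x \<otimes>\<^bsub>A\<^esub> a) \<ominus>\<^bsub>R\<^esub> u x)" if "x \<in> carrier A" for x
      using that a assms(4) by (simp add: fdiff_def)
    moreover have "deg_less A C (carrier A) n (\<lambda>x. \<psi> (u (x \<otimes>\<^bsub>A\<^esub> a) \<ominus>\<^bsub>R\<^esub> u x))"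
      using a Suc.prems by (intro Suc.IH[of "\<lambda>i. W (Suc i)"]) auto
    ultimately show ?thesis by (subst AC.deg_less_cong) auto
  qed
  then show ?case by simp
qed auto

end

section \<open>The weight filtration of the group ring\<close>

context comm_group_pair
begin

text \<open>
  This is \<open>Ann S \<lceil>i / d\<rceil>\<close> for \<open>d > 0\<close>; the formulation also covers \<open>d = 0\<close>, where the ceiling is
  infinite for \<open>i > 0\<close>.
\<close>

definition weight_ideal :: "'a set \<Rightarrow> nat \<Rightarrow> nat \<Rightarrow> ('a \<Rightarrow>\<^sub>0 int) set" where
  "weight_ideal S d i = {z \<in> carrier R. \<forall>p. d * p < i \<longrightarrow> z \<in> Ann S (Suc p)}"

lemma weight_ideal_carrier: "weight_ideal S d i \<subseteq> carrier R"
  by (auto simp: weight_ideal_def)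

lemma weight_ideal_0: "weight_ideal S d 0 = carrier R"
  by (auto simp: weight_ideal_def)

lemma weight_ideal_antimono: "weight_ideal S d (Suc i) \<subseteq> weight_ideal S d i"
  by (auto simp: weight_ideal_def)

lemma weight_ideal_add:
  assumes "z \<in> weight_ideal S d i" "w \<in> weight_ideal S d i" shows "z \<oplus>\<^bsub>R\<^esub> w \<in> weight_ideal S d i"
proof -
  have "z \<oplus>\<^bsub>R\<^esub> w \<in> Ann S n" if "z \<in> Ann S n" "w \<in> Ann S n" for n
    by (rule additive_subgroup.a_closed[OF ideal.axioms(1)[OF ideal_Ann] that])
  moreover have "z \<oplus>\<^bsub>R\<^esub> w \<in> carrier R"
    using assms by (intro R.add.m_closed) (auto simp: weight_ideal_def)
  ultimately show ?thesis
    using assms by (simp add: weight_ideal_def del: add_R)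
qed

text \<open>The ceiling of \<open>(i + j) / d\<close> is at most the sum of the ceilings of
  \<open>i / d\<close> and \<open>j / d\<close>, and \<open>Ann_mult\<close> adds the
  indices.\<close>

lemma weight_ideal_mult:
  assumes z: "z \<in> weight_ideal S d i" and w: "w \<in> weight_ideal S d j" and S: "S \<subseteq> carrier A"
  shows "z \<otimes>\<^bsub>R\<^esub> w \<in> weight_ideal S d (i + j)"
proof -
  have R: "z \<in> carrier R" "w \<in> carrier R" using z w by (auto simp: weight_ideal_def)
  have "z \<otimes>\<^bsub>R\<^esub> w \<in> Ann S (Suc p)" if p: "d * p < i + j" for p
  proof (cases "d * p < i")
    case True
    then show ?thesis using z R by (auto simp: weight_ideal_def intro: ideal.I_r_closed[OF ideal_Ann])
  next
    case False
    \<comment> \<open>This is the ceiling of \<open>i / d\<close>. If it is 0, then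
      \<open>i = 0\<close> and \<open>w\<close> alone suffices; otherwise \<open>z\<close>
      contributes index \<open>q\<close> and \<open>w\<close> contributes
      \<open>p - q + 1\<close>.\<close>
    define q where "q = (LEAST q. i \<le> d * q)"
    have "i \<le> d * q" unfolding q_def by (rule LeastI[of _ p]) (use False in simp)
    have "q \<le> p" unfolding q_def by (rule Least_le) (use False in simp)
    show ?thesis
    proof (cases q)
      case 0
      then have "w \<in> Ann S (Suc p)" using \<open>i \<le> d * q\<close> p w by (simp add: weight_ideal_def)
      then show ?thesis using R by (auto intro: ideal.I_l_closed[OF ideal_Ann])
    next
      case (Suc r)
      have "d * r < i" using not_less_Least[of r "\<lambda>q. i \<le> d * q"] Suc by (simp add: q_def)
      then have "z \<in> Ann S (Suc r)" using z by (simp add: weight_ideal_def)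
      moreover have "d * (p - q) < j"
        using p \<open>i \<le> d * q\<close> mult_le_mono2[OF \<open>q \<le> p\<close>, of d]
        unfolding diff_mult_distrib2 by linarith
      then have "w \<in> Ann S (Suc (p - q))" using w by (simp add: weight_ideal_def)
      ultimately have "z \<otimes>\<^bsub>R\<^esub> w \<in> Ann S (Suc r + Suc (p - q))" using S by (rule Ann_mult)
      then show ?thesis using \<open>q \<le> p\<close> Suc by simp
    qed
  qed
  then show ?thesis using R by (simp add: weight_ideal_def)
qed

text \<open>Subtracting the unit puts the values into \<open>Ann S 1\<close>, which gains the first
  step of weight. In the differences the units cancel, and those of \<tau> are controlled by
  \<open>IH\<close>.\<close>

lemma filt_shifted_tau_minus_one:
  assumes "comm_group M" "\<iota> \<in> hom B A" "h \<in> carrier M \<rightarrow> carrier B"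
    and IH: "\<And>n. filt M R n (weight_ideal (\<iota> ` carrier B) d) (\<lambda>x. frag_of (\<iota> (h x)))"
  shows "filt M R n (\<lambda>i. weight_ideal (\<iota> ` carrier B) (Suc d) (Suc i))
    (\<lambda>x. frag_of (\<iota> (h x)) \<ominus>\<^bsub>R\<^esub> frag_of \<one>\<^bsub>A\<^esub>)"
proof -
  let ?S = "\<iota> ` carrier B" and ?u = "\<lambda>x. frag_of (\<iota> (h x))"
  interpret M: comm_group M by fact
  interpret filtered_maps M R by unfold_locales
  have S: "?S \<subseteq> carrier A" using assms(2) by (auto simp: hom_def)
  have cl: "\<iota> (h x) \<in> carrier A" "\<iota> (h x) \<in> ?S" if "x \<in> carrier M" for x
    using that assms(2,3) S by auto
  have base: "?u x \<ominus>\<^bsub>R\<^esub> frag_of \<one>\<^bsub>A\<^esub> \<in> weight_ideal ?S (Suc d) (Suc 0)" if "x \<in> carrier M" for x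
    using cl[OF that] frag_diff_Ann[OF cl(2)[OF that] S] by (auto simp: weight_ideal_def diff_closed)
  show ?thesis
  proof (cases n)
    case 0
    then show ?thesis using base by simp
  next
    case (Suc m)
    \<comment> \<open>If \<open>(d + 1) * p < i + 2\<close> with \<open>p > 0\<close>, dropping one
      \<open>p\<close> on the left lowers the bound by at least one.\<close>
    have sub: "weight_ideal ?S d (Suc i) \<subseteq> weight_ideal ?S (Suc d) (Suc (Suc i))" for i
    proof -
      have "d * p < Suc i" if "Suc d * p < Suc (Suc i)" for p
        using that by (cases p) auto
      then show ?thesis by (auto simp: weight_ideal_def)
    qed
    have "filtered m (\<lambda>i. weight_ideal ?S (Suc d) (Suc (Suc i)))
        (\<lambda>x. (?u (x \<otimes>\<^bsub>M\<^esub> a) \<ominus>\<^bsub>R\<^esub> frag_of \<one>\<^bsub>A\<^esub>) \<ominus>\<^bsub>R\<^esub> (?u x \<ominus>\<^bsub>R\<^esub> frag_of \<one>\<^bsub>A\<^esub>))"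
      if a: "a \<in> carrier M" for a
    proof -
      have "filtered m (\<lambda>i. weight_ideal ?S d (Suc i)) (\<lambda>x. ?u (x \<otimes>\<^bsub>M\<^esub> a) \<ominus>\<^bsub>R\<^esub> ?u x)"
        using IH[of "Suc m"] a by simp
      from filt_mono[OF this sub] show ?thesis
        by (subst filt_cong) (use cl a in \<open>auto simp: diff_closed\<close>)
    qed
    then show ?thesis using base Suc by simp
  qed
qed

text \<open>In \<open>\<tau>\<^sub>h (\<tau>\<^sub>h\<^sub>' - 1)\<close> the outer induction on
  \<open>d\<close> handles the right factor, as \<open>h'\<close> has smaller degree, and the inner
  one on \<open>n\<close> handles \<open>\<tau>\<^sub>h\<close> with fewer differences.\<close>

lemma filt_tau:
  assumes "comm_group M" "comm_group B" "\<iota> \<in> hom B A" "h \<in> carrier M \<rightarrow> carrier B"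
    and "deg_less M B (carrier M) (Suc d) h"
  shows "filt M R n (weight_ideal (\<iota> ` carrier B) d) (\<lambda>x. frag_of (\<iota> (h x)))"
  using assms(4,5)
proof (induction d arbitrary: h n)
  interpret M: comm_group M by fact
  interpret B: comm_group B by fact
  interpret filtered_maps M R by unfold_locales
  interpret MB: comm_group_pair M B by unfold_locales
  let ?S = "\<iota> ` carrier B"
  {
    case 0
    show ?case
    \<comment> \<open>For \<open>d = 0\<close> positive weight demands membership in every
      \<open>Ann S (Suc p)\<close>; the differences meet this by being 0, since \<open>h\<close> is
      constant.\<close>
    proof (rule filt_const_mod[where K = "{\<zero>\<^bsub>R\<^esub>}"])
      show "ideal {\<zero>\<^bsub>R\<^esub>} R" by (rule R.zeroideal)
      show "{\<zero>\<^bsub>R\<^esub>} \<subseteq> weight_ideal ?S 0 (Suc i)" for i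
        using additive_subgroup.zero_closed[OF ideal.axioms(1)[OF ideal_Ann]] R.zero_closed
        by (auto simp: weight_ideal_def)
      fix x assume x: "x \<in> carrier M"
      show "frag_of (\<iota> (h x)) \<in> weight_ideal ?S 0 0"
        using x 0 assms(3) by (auto simp: weight_ideal_0 hom_def Pi_iff)
      fix a assume a: "a \<in> carrier M"
      have "h (x \<otimes>\<^bsub>M\<^esub> a) = h x" using 0(2,1) x a by (rule MB.deg_less_one_const) simp
      then show "frag_of (\<iota> (h (x \<otimes>\<^bsub>M\<^esub> a))) \<ominus>\<^bsub>R\<^esub> frag_of (\<iota> (h x)) \<in> {\<zero>\<^bsub>R\<^esub>}"
        using 0(1) x assms(3) by (auto simp: hom_def Pi_iff)
    qed
  next
    case (Suc d)
    let ?W = "weight_ideal ?S (Suc d)" and ?u = "\<lambda>x. frag_of (\<iota> (h x))"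
    have S: "?S \<subseteq> carrier A" using assms(3) by (auto simp: hom_def)
    have cl: "\<iota> (h x) \<in> carrier A" if "x \<in> carrier M" for x
      using that assms(3) Suc.prems by (auto simp: hom_def Pi_iff)
    show ?case
    proof (induction n)
      case 0
      then show ?case using cl by (simp add: weight_ideal_0)
    next
      case (Suc n)
      have "filtered n (\<lambda>i. ?W (Suc i)) (\<lambda>x. ?u (x \<otimes>\<^bsub>M\<^esub> a) \<ominus>\<^bsub>R\<^esub> ?u x)" if a: "a \<in> carrier M" for a
      proof -
        define h' where "h' = fdiff M B a h"
        have h': "h' \<in> carrier M \<rightarrow> carrier B" "deg_less M B (carrier M) (Suc d) h'"
          using Suc.prems a \<open>h \<in> _\<close> \<open>deg_less M B (carrier M) (Suc (Suc d)) h\<close>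
          by (auto simp: h'_def fdiff_def Pi_iff)
        have "filtered n (\<lambda>i. ?W (Suc i)) (\<lambda>x. ?u x \<otimes>\<^bsub>R\<^esub> (frag_of (\<iota> (h' x)) \<ominus>\<^bsub>R\<^esub> frag_of \<one>\<^bsub>A\<^esub>))"
        proof (rule filt_mult[where W = ?W and V = "\<lambda>i. ?W (Suc i)"])
          show "filtered n ?W ?u" by (rule Suc.IH)
          show "filtered n (\<lambda>i. ?W (Suc i)) (\<lambda>x. frag_of (\<iota> (h' x)) \<ominus>\<^bsub>R\<^esub> frag_of \<one>\<^bsub>A\<^esub>)"
            by (rule filt_shifted_tau_minus_one[OF assms(1,3) h'(1)])
              (rule \<open>\<And>h n. h \<in> _ \<Longrightarrow> _ \<Longrightarrow> filtered n (weight_ideal ?S d) _\<close>[OF h'])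
          show "z \<otimes>\<^bsub>R\<^esub> w \<in> ?W (Suc (i + j))" if "z \<in> ?W i" "w \<in> ?W (Suc j)" for i j z w
            using weight_ideal_mult[OF that S] by simp
        qed (use weight_ideal_carrier weight_ideal_antimono weight_ideal_add in auto)
        moreover have "?u (x \<otimes>\<^bsub>M\<^esub> a) \<ominus>\<^bsub>R\<^esub> ?u x = ?u x \<otimes>\<^bsub>R\<^esub> (frag_of (\<iota> (h' x)) \<ominus>\<^bsub>R\<^esub> frag_of \<one>\<^bsub>A\<^esub>)"
          if x: "x \<in> carrier M" for x
        proof -
          have hB: "h x \<in> carrier B" "h' x \<in> carrier B" "h (x \<otimes>\<^bsub>M\<^esub> a) \<in> carrier B"
            using x a h' \<open>h \<in> _\<close> by auto
          have "h (x \<otimes>\<^bsub>M\<^esub> a) = h x \<otimes>\<^bsub>B\<^esub> h' x"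
            using hB by (simp add: h'_def fdiff_def B.m_comm[of "h x"] B.m_assoc)
          then have "\<iota> (h (x \<otimes>\<^bsub>M\<^esub> a)) = \<iota> (h x) \<otimes>\<^bsub>A\<^esub> \<iota> (h' x)"
            using hB assms(3) by (simp add: hom_mult)
          moreover have "\<iota> (h' x) \<in> carrier A"
            using hB S by auto
          ultimately show ?thesis
            using cl[OF x] by (simp add: diff_mult frag_of_mult)
        qed
        ultimately show ?thesis by (subst filt_cong) auto
      qed
      moreover have "?u x \<in> ?W 0" if "x \<in> carrier M" for x
        using that cl by (simp add: weight_ideal_0)
      ultimately show ?case by simp
    qed
  }
qed

text \<open>The weight ideals of different coordinates use different directions \<open>S\<close>.
  Keeping only whether \<open>g\<close> itself is killed gives filtrations that can be multiplied
  across coordinates.\<close>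

definition cutoff_ideal :: "('a \<Rightarrow> 'c) \<Rightarrow> nat \<Rightarrow> nat \<Rightarrow> ('a \<Rightarrow>\<^sub>0 int) set" where
  "cutoff_ideal g c j = {z \<in> carrier R. c < j \<longrightarrow> (\<forall>x\<in>carrier A. act z g x = \<one>\<^bsub>C\<^esub>)}"

lemma cutoff_ideal_carrier: "cutoff_ideal g c j \<subseteq> carrier R"
  and cutoff_ideal_0: "cutoff_ideal g c 0 = carrier R"
  and cutoff_ideal_antimono: "cutoff_ideal g c (Suc j) \<subseteq> cutoff_ideal g c j"
  by (auto simp: cutoff_ideal_def)

lemma zero_cutoff_ideal: "\<zero>\<^bsub>R\<^esub> \<in> cutoff_ideal g c j"
  using R.zero_closed by (simp add: cutoff_ideal_def)

lemma cutoff_ideal_add: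
  assumes "g \<in> Maps" "z \<in> cutoff_ideal g c j" "w \<in> cutoff_ideal g c j"
  shows "z \<oplus>\<^bsub>R\<^esub> w \<in> cutoff_ideal g c j"
  using assms R.add.m_closed[of z w] by (auto simp: cutoff_ideal_def act_add)

text \<open>If \<open>c + d < i + j\<close>, then \<open>c < i\<close> or \<open>d < j\<close>, so
  one factor already lies in the annihilator of \<open>g\<close>, which is an ideal.\<close>

lemma cutoff_ideal_mult:
  assumes "g \<in> Maps" "z \<in> cutoff_ideal g c i" "w \<in> cutoff_ideal g d j"
  shows "z \<otimes>\<^bsub>R\<^esub> w \<in> cutoff_ideal g (c + d) (i + j)"
proof -
  let ?I = "{z \<in> carrier R. \<forall>f\<in>{g}. \<forall>x\<in>carrier A. act z f x = \<one>\<^bsub>C\<^esub>}"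
  have I: "ideal ?I R" using assms(1) by (intro ideal_act_eq_one) auto
  have R: "z \<in> carrier R" "w \<in> carrier R" using assms by (auto simp: cutoff_ideal_def)
  have "z \<otimes>\<^bsub>R\<^esub> w \<in> ?I" if "c + d < i + j"
  proof -
    have "c < i \<or> d < j" using that by linarith
    then have "z \<in> ?I \<or> w \<in> ?I" using assms by (auto simp: cutoff_ideal_def)
    then show ?thesis
      using ideal.I_l_closed[OF I _ R(1)] ideal.I_r_closed[OF I _ R(2)] by blast
  qed
  then show ?thesis using R by (simp add: cutoff_ideal_def)
qed

text \<open>Infinite degrees are allowed as long as the other one is \<open>0\<close>.\<close>

lemma filt_tau_cutoff:
  fixes D E :: enat
  assumes "comm_group M" "comm_group B" "\<iota> \<in> hom B A" "h \<in> carrier M \<rightarrow> carrier B" "g \<in> Maps"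
    and E: "\<And>e. E = enat e \<Longrightarrow> deg_less A C (\<iota> ` carrier B) (Suc e) g"
    and D: "\<And>d. D = enat d \<Longrightarrow> deg_less M B (carrier M) (Suc d) h"
    and c: "E * D = enat c"
  shows "filt M R n (cutoff_ideal g c) (\<lambda>x. frag_of (\<iota> (h x)))"
proof -
  interpret M: comm_group M by fact
  interpret B: comm_group B by fact
  interpret filtered_maps M R by unfold_locales
  interpret MB: comm_group_pair M B by unfold_locales
  let ?S = "\<iota> ` carrier B"
  have S: "?S \<subseteq> carrier A" using assms(3) by (auto simp: hom_def)
  have cl: "\<iota> (h x) \<in> carrier A" "\<iota> (h x) \<in> ?S" if "x \<in> carrier M" for x
    using that assms(3,4) S by auto
  consider "E = 0" | "D = 0" | d e where "E = enat e" "D = enat d" "c = e * d"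
    using c by (cases E; cases D) (auto simp: zero_enat_def split: if_splits)
  then show ?thesis
  proof cases
    case 1
    \<comment> \<open>For \<open>E = 0\<close> the function \<open>g\<close> is invariant under
      translation by \<open>?S\<close>, so differences of \<tau> kill \<open>g\<close> whatever
      \<open>h\<close> is.\<close>
    let ?K = "{z \<in> carrier R. \<forall>f\<in>{g}. \<forall>x\<in>carrier A. act z f x = \<one>\<^bsub>C\<^esub>}"
    show ?thesis
    proof (rule filt_const_mod[where K = ?K])
      show "ideal ?K R" using assms(5) by (intro ideal_act_eq_one) auto
      show "?K \<subseteq> cutoff_ideal g c (Suc i)" for i by (auto simp: cutoff_ideal_def)
      show "frag_of (\<iota> (h x)) \<in> cutoff_ideal g c 0" if "x \<in> carrier M" for x
        using cl that by (simp add: cutoff_ideal_0)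
      show "frag_of (\<iota> (h (x \<otimes>\<^bsub>M\<^esub> a))) \<ominus>\<^bsub>R\<^esub> frag_of (\<iota> (h x)) \<in> ?K"
        if "x \<in> carrier M" "a \<in> carrier M" for x a
      proof -
        have "deg_less A C ?S (Suc 0) g" using 1 E[of 0] by (simp add: zero_enat_def)
        then have "g (y \<otimes>\<^bsub>A\<^esub> s) = g y" if "y \<in> carrier A" "s \<in> ?S" for y s
          using assms(5) that S by (rule deg_less_one_const)
        then show ?thesis
          using that cl[of x] cl[of "x \<otimes>\<^bsub>M\<^esub> a"] assms(5)
          by (auto simp: act_diff act_frag_of diff_closed Pi_iff)
      qed
    qed
  next
    case 2
    show ?thesis
    proof (rule filt_const_mod[where K = "{\<zero>\<^bsub>R\<^esub>}"])
      show "frag_of (\<iota> (h x)) \<in> cutoff_ideal g c 0" if "x \<in> carrier M" for x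
        using cl that by (simp add: cutoff_ideal_0)
      show "frag_of (\<iota> (h (x \<otimes>\<^bsub>M\<^esub> a))) \<ominus>\<^bsub>R\<^esub> frag_of (\<iota> (h x)) \<in> {\<zero>\<^bsub>R\<^esub>}"
        if "x \<in> carrier M" "a \<in> carrier M" for x a
        using that cl[of x] MB.deg_less_one_const[OF _ assms(4)] 2 D[of 0]
        by (simp add: zero_enat_def)
    qed (auto intro: R.zeroideal zero_cutoff_ideal simp del: zero_R)
  next
    case 3
    \<comment> \<open>If \<open>e * d < i\<close>, weight \<open>i\<close> gives membership in
      \<open>Ann ?S (Suc e)\<close>, and \<open>g\<close> has degree at most \<open>e\<close> in
      these directions.\<close>
    have "weight_ideal ?S d i \<subseteq> cutoff_ideal g c i" for i
      using E[OF 3(1)] assms(5) by (auto simp: weight_ideal_def cutoff_ideal_def Ann_def 3(3) mult.commute)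
    then show ?thesis
      using filt_mono[OF filt_tau[OF assms(1-4) D[OF 3(2)]]] by blast
  qed
qed

end

section \<open>Coordinates of a product group\<close>

lemma comm_group_product_group:
  assumes "\<And>i. i \<in> I \<Longrightarrow> comm_group (B i)"
  shows "comm_group (product_group I B)"
proof (rule group.group_comm_groupI)
  show "group (product_group I B)"
    using assms by (simp add: comm_group.axioms(2))
  show "x \<otimes>\<^bsub>product_group I B\<^esub> y = y \<otimes>\<^bsub>product_group I B\<^esub> x"
    if "x \<in> carrier (product_group I B)" "y \<in> carrier (product_group I B)" for x y
    using that assms by (auto intro!: restrict_ext comm_monoid.m_comm comm_group.axioms(1))
qed

definition coord_emb :: "'i set \<Rightarrow> ('i \<Rightarrow> ('b, 'm) monoid_scheme) \<Rightarrow> 'i \<Rightarrow> 'b \<Rightarrow> 'i \<Rightarrow> 'b" where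
  "coord_emb I B i x = (\<lambda>j\<in>I. if j = i then x else \<one>\<^bsub>B j\<^esub>)"

lemma coord_emb_hom:
  assumes "\<And>i. i \<in> I \<Longrightarrow> comm_group (B i)"
  shows "coord_emb I B i \<in> hom (B i) (product_group I B)"
proof -
  have "\<one>\<^bsub>B j\<^esub> \<in> carrier (B j)" "\<one>\<^bsub>B j\<^esub> \<otimes>\<^bsub>B j\<^esub> \<one>\<^bsub>B j\<^esub> = \<one>\<^bsub>B j\<^esub>" if "j \<in> I" for j
    using assms[OF that] by (simp_all add: comm_group_def comm_monoid_def)
  then show ?thesis
    by (auto simp: hom_def coord_emb_def fun_eq_iff)
qed

lemma mult_coord_emb:
  assumes "\<And>i. i \<in> I \<Longrightarrow> comm_group (B i)" "b \<in> carrier (product_group I B)"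
  shows "b(i := x) \<otimes>\<^bsub>product_group I B\<^esub> coord_emb I B i s =
    (\<lambda>j\<in>I. (b(i := x \<otimes>\<^bsub>B i\<^esub> s)) j)"
proof -
  have "b j \<otimes>\<^bsub>B j\<^esub> \<one>\<^bsub>B j\<^esub> = b j" if "j \<in> I" for j
    using assms that by (auto simp: comm_group_def comm_monoid_def intro!: monoid.r_one)
  then show ?thesis
    by (auto simp: coord_emb_def fun_eq_iff)
qed

text \<open>Restricting to the line through \<open>b\<close> in direction \<open>i\<close> turns the
  difference of \<open>g\<close> by \<open>coord_emb I B i s\<close> into the difference by
  \<open>s\<close> of the restriction.\<close>

lemma deg_less_coord:
  assumes B: "\<And>i. i \<in> I \<Longrightarrow> comm_group (B i)" and "i \<in> I" "comm_group C"
    and "\<And>b. b \<in> carrier (product_group I B) \<Longrightarrow> deg_less (B i) C (carrier (B i)) n (\<lambda>x. g (b(i := x)))"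
  shows "deg_less (product_group I B) C (coord_emb I B i ` carrier (B i)) n g"
  using assms(4)
proof (induction n arbitrary: g)
  case 0
  show ?case
  proof (unfold deg_less.simps, rule ballI)
    fix b assume b: "b \<in> carrier (product_group I B)"
    then have "b i \<in> carrier (B i)" using \<open>i \<in> I\<close> by auto
    then show "g b = \<one>\<^bsub>C\<^esub>" using 0[OF b] by (metis deg_less.simps(1) fun_upd_triv)
  qed
next
  case (Suc n)
  let ?P = "product_group I B"
  have "deg_less ?P C (coord_emb I B i ` carrier (B i)) n (fdiff ?P C (coord_emb I B i s) g)"
    if s: "s \<in> carrier (B i)" for s
  proof (rule Suc.IH)
    fix b assume b: "b \<in> carrier ?P"
    have "b(i := x) \<otimes>\<^bsub>?P\<^esub> coord_emb I B i s = b(i := x \<otimes>\<^bsub>B i\<^esub> s)" for x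
    proof -
      have "b(i := x) \<otimes>\<^bsub>?P\<^esub> coord_emb I B i s = (\<lambda>j\<in>I. (b(i := x \<otimes>\<^bsub>B i\<^esub> s)) j)"
        using B b by (rule mult_coord_emb)
      also have "\<dots> = b(i := x \<otimes>\<^bsub>B i\<^esub> s)"
        using b \<open>i \<in> I\<close> by (auto simp: fun_eq_iff PiE_def extensional_def)
      finally show ?thesis .
    qed
    then have "(\<lambda>x. fdiff ?P C (coord_emb I B i s) g (b(i := x))) = fdiff (B i) C s (\<lambda>x. g (b(i := x)))"
      unfolding fdiff_def by (intro ext) simp
    then show "deg_less (B i) C (carrier (B i)) n (\<lambda>x. fdiff ?P C (coord_emb I B i s) g (b(i := x)))"
      using Suc.prems[OF b] s by (simp only: deg_less.simps)
  qed
  then show ?case by simp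
qed

lemma deg_less_if_Pdeg_le:
  assumes B: "\<And>i. i \<in> I \<Longrightarrow> comm_group (B i)" and i: "i \<in> I" and "comm_group C"
    and g: "g \<in> carrier (product_group I B) \<rightarrow> carrier C" and "Pdeg I B C i g \<le> enat e"
  shows "deg_less (product_group I B) C (coord_emb I B i ` carrier (B i)) (Suc e) g"
proof (rule deg_less_coord[OF B i assms(3)])
  fix b assume b: "b \<in> carrier (product_group I B)"
  interpret comm_group_pair "B i" C
    using B i assms(3) by (simp add: comm_group_pair_def)
  have "b(i := x) \<in> carrier (product_group I B)" if "x \<in> carrier (B i)" for x
    using b i that by (auto simp: PiE_iff extensional_def)
  then have "(\<lambda>x. g (b(i := x))) \<in> Maps" using g by blast
  moreover have "Fdeg (B i) C (\<lambda>x. g (b(i := x))) \<le> Pdeg I B C i g"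
    unfolding Pdeg_def by (rule SUP_upper[OF b])
  then have "Fdeg (B i) C (\<lambda>x. g (b(i := x))) \<le> enat e"
    using assms(5) by (rule order_trans)
  ultimately show "deg_less (B i) C (carrier (B i)) (Suc e) (\<lambda>x. g (b(i := x)))"
    by (simp only: Fdeg_le_iff)
qed

section \<open>The composition bound, assembled one coordinate at a time\<close>

theorem theorem5p3:
  fixes k :: nat
    and A :: "('a, 'p) monoid_scheme"
    and B :: "nat \<Rightarrow> ('b, 'q) monoid_scheme"
    and C :: "('c, 'r) monoid_scheme"
    and f :: "nat \<Rightarrow> 'a \<Rightarrow> 'b"
    and g :: "(nat \<Rightarrow> 'b) \<Rightarrow> 'c"
    and G :: "'a \<Rightarrow> 'c"
  assumes "k \<ge> 1"
    and "\<And>i. i \<in> {1..k} \<Longrightarrow> comm_group (B i)"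
    and "comm_group A" and "comm_group C"
    and "\<And>i. i \<in> {1..k} \<Longrightarrow> f i \<in> carrier A \<rightarrow> carrier (B i)"
    and "g \<in> carrier (product_group {1..k} B) \<rightarrow> carrier C"
    and "\<And>a. a \<in> carrier A \<Longrightarrow> G a = g (\<lambda>i\<in>{1..k}. f i a)"
  shows "Fdeg A C G \<le> (\<Sum>i=1..k. Pdeg {1..k} B C i g * Fdeg A (B i) (f i))"
proof (cases "\<exists>i\<in>{1..k}. Pdeg {1..k} B C i g * Fdeg A (B i) (f i) = \<infinity>")
  case True
  then obtain i where i: "i \<in> {1..k}" "Pdeg {1..k} B C i g * Fdeg A (B i) (f i) = \<infinity>" by blast
  have "(\<infinity>::enat) \<le> (\<Sum>i=1..k. Pdeg {1..k} B C i g * Fdeg A (B i) (f i))"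
    using member_le_sum[of i "{1..k}" "\<lambda>i. Pdeg {1..k} B C i g * Fdeg A (B i) (f i)"] i by simp
  then show ?thesis by simp
next
  case False
  define I where "I = {1..k}"
  define P where "P = product_group I B"
  \<comment> \<open>All these products are finite here, although a single degree may be infinite
    opposite a zero.\<close>
  define c where "c i = the_enat (Pdeg I B C i g * Fdeg A (B i) (f i))" for i
  have c: "Pdeg I B C i g * Fdeg A (B i) (f i) = enat (c i)" if "i \<in> I" for i
  proof -
    have "Pdeg I B C i g * Fdeg A (B i) (f i) \<noteq> \<infinity>" using False that unfolding I_def by metis
    then obtain m where "Pdeg I B C i g * Fdeg A (B i) (f i) = enat m" by (meson not_infinity_eq)
    then show ?thesis by (simp add: c_def)
  qed
  have B: "comm_group (B i)" if "i \<in> I" for i using assms(2) that by (simp add: I_def)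
  have f: "f i \<in> carrier A \<rightarrow> carrier (B i)" if "i \<in> I" for i using assms(5) that by (simp add: I_def)
  have g: "g \<in> carrier P \<rightarrow> carrier C" using assms(6) by (simp add: P_def I_def)
  interpret A: comm_group A by fact
  interpret C: comm_group C by fact
  interpret P: comm_group P unfolding P_def using B by (rule comm_group_product_group)
  interpret PC: comm_group_pair P C by unfold_locales
  interpret AC: comm_group_pair A C by unfold_locales
  interpret filtered_maps A PC.R by unfold_locales
  \<comment> \<open>\<open>F m\<close> interpolates between the identity of \<open>P\<close> at
    \<open>m = 0\<close> and the full tuple at \<open>m = k\<close>. Each step multiplies by one
    embedded coordinate, so the cutoffs in \<open>main\<close> add up.\<close>
  define F where "F m a = (\<lambda>i\<in>I. if i \<le> m then f i a else \<one>\<^bsub>B i\<^esub>)" for m a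
  have one: "\<one>\<^bsub>B i\<^esub> \<in> carrier (B i)" if "i \<in> I" for i
    using B[OF that] by (simp add: comm_group_def comm_monoid_def)
  have F: "F m a \<in> carrier P" if "a \<in> carrier A" for m a
    using that f one by (auto simp: F_def P_def Pi_iff)
  have factor: "filtered n (PC.cutoff_ideal g (c i)) (\<lambda>a. frag_of (coord_emb I B i (f i a)))" if i: "i \<in> I" for i n
  proof (rule PC.filt_tau_cutoff[OF assms(3) B[OF i] _ f[OF i] g])
    interpret AB: comm_group_pair A "B i" using assms(3) B[OF i] by (simp add: comm_group_pair_def)
    show "coord_emb I B i \<in> hom (B i) P" unfolding P_def using B by (rule coord_emb_hom)
    show "deg_less P C (coord_emb I B i ` carrier (B i)) (Suc e) g" if "Pdeg I B C i g = enat e" for e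
      using deg_less_if_Pdeg_le[OF B i assms(4) g[unfolded P_def], of e] that by (simp add: P_def)
    show "deg_less A (B i) (carrier A) (Suc d) (f i)" if "Fdeg A (B i) (f i) = enat d" for d
      using AB.Fdeg_le_iff[OF f[OF i], of d] that by simp
  qed (rule c[OF i])
  have main: "filtered n (PC.cutoff_ideal g (\<Sum>i=1..m. c i)) (\<lambda>a. frag_of (F m a))" if "m \<le> k" for m n
    using that
  proof (induction m)
    case 0
    have "F 0 a = \<one>\<^bsub>P\<^esub>" for a by (auto simp: F_def P_def I_def)
    then show ?case
    proof (intro filt_const_mod[where K = "{\<zero>\<^bsub>PC.R\<^esub>}"])
      show "{\<zero>\<^bsub>PC.R\<^esub>} \<subseteq> PC.cutoff_ideal g (sum c {1..0}) (Suc i)" for i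
        using PC.zero_cutoff_ideal by blast
    qed (auto simp: PC.cutoff_ideal_0 PC.R.zeroideal[simplified])
  next
    case (Suc m)
    then have mI: "Suc m \<in> I" by (simp add: I_def)
    have "filtered n (PC.cutoff_ideal g ((\<Sum>i=1..m. c i) + c (Suc m)))
        (\<lambda>a. frag_of (F m a) \<otimes>\<^bsub>PC.R\<^esub> frag_of (coord_emb I B (Suc m) (f (Suc m) a)))"
      by (rule filt_mult[OF Suc.IH factor[OF mI]])
        (use Suc.prems PC.cutoff_ideal_carrier PC.cutoff_ideal_antimono PC.cutoff_ideal_add[OF g] PC.cutoff_ideal_mult[OF g] in auto)
    moreover have "frag_of (F m a) \<otimes>\<^bsub>PC.R\<^esub> frag_of (coord_emb I B (Suc m) (f (Suc m) a)) =
        frag_of (F (Suc m) a)" if a: "a \<in> carrier A" for a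
    proof -
      have "F m a \<otimes>\<^bsub>P\<^esub> coord_emb I B (Suc m) (f (Suc m) a) = F (Suc m) a"
      proof
        fix j
        show "(F m a \<otimes>\<^bsub>P\<^esub> coord_emb I B (Suc m) (f (Suc m) a)) j = F (Suc m) a j"
        proof (cases "j \<in> I")
          case True
          interpret Bj: comm_group "B j" using B True .
          have "f j a \<in> carrier (B j)" using f[OF True] a by auto
          then have "f j a \<otimes>\<^bsub>B j\<^esub> \<one>\<^bsub>B j\<^esub> = f j a" "\<one>\<^bsub>B j\<^esub> \<otimes>\<^bsub>B j\<^esub> f j a = f j a" by simp_all
          then show ?thesis using True by (auto simp: F_def P_def coord_emb_def)
        qed (simp add: F_def P_def)
      qed
      then show ?thesis by (simp add: PC.frag_of_mult)
    qed
    ultimately show ?case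
      by (subst filt_cong[of _ "\<lambda>a. frag_of (F m a) \<otimes>\<^bsub>PC.R\<^esub> frag_of (coord_emb I B (Suc m) (f (Suc m) a))"])
        auto
  qed
  let ?N = "\<Sum>i=1..k. c i"
  \<comment> \<open>The additive map for \<open>deg_less_if_filt\<close> is evaluation of
    \<open>z * g\<close> at the identity; it vanishes at index \<open>Suc ?N\<close>, the first one
    beyond the cutoff.\<close>
  have "deg_less A C (carrier A) (Suc ?N) (\<lambda>a. PC.act (frag_of (F k a)) g \<one>\<^bsub>P\<^esub>)"
  proof (rule deg_less_if_filt[OF main[OF order_refl] PC.cutoff_ideal_carrier assms(4)])
    show "PC.act z g \<one>\<^bsub>P\<^esub> = \<one>\<^bsub>C\<^esub>" if "z \<in> PC.cutoff_ideal g ?N (Suc ?N)" for z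
      using that by (simp add: PC.cutoff_ideal_def)
  qed (use g in \<open>simp add: PC.act_diff\<close>)
  moreover have "PC.act (frag_of (F k a)) g \<one>\<^bsub>P\<^esub> = G a" if a: "a \<in> carrier A" for a
  proof -
    have "F k a = (\<lambda>i\<in>{1..k}. f i a)" by (auto simp: F_def I_def)
    then show ?thesis using F[OF a, of k] g assms(7)[OF a] by (simp add: PC.act_frag_of)
  qed
  ultimately have "deg_less A C (carrier A) (Suc ?N) G"
    by (subst AC.deg_less_cong[of G]) auto
  moreover have "G \<in> carrier A \<rightarrow> carrier C"
    using assms(5-7) by (fastforce simp: Pi_iff)
  ultimately have "Fdeg A C G \<le> enat ?N"
    by (simp add: AC.Fdeg_le_iff)
  also have "enat ?N = (\<Sum>i=1..k. enat (c i))"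
    by (induction k) (simp_all add: zero_enat_def flip: plus_enat_simps(1))
  also have "\<dots> = (\<Sum>i=1..k. Pdeg {1..k} B C i g * Fdeg A (B i) (f i))"
    using c by (intro sum.cong) (auto simp: I_def)
  finally show ?thesis .
qed

end
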